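(* For every positive integer $n$, \[ \underline{\mathrm{BR}}(\mathbb{L}_n^+)=\Bigl\{(\alpha_{ij})_{1\le i<j\le n}\in\mathbb{R}^{\binom n2} \;\Bigm|\; \sum_{1\le i<j\le n}\alpha_{ij}\beta_{ij}\le 0 \text{ for all } (\beta_{ij})_{1\le i<j\le n}\in \mathrm{Cut}_n\Bigr\}, \] i.e. the cone of reduced bounded ratios on $\mathbb{L}_n^+$ is the dual of the cut cone. In particular, the cone of bounded ratios $\mathrm{BR}(\mathbb{L}_n^+)$ is a finitely generated polyhedral cone generated by integral vectors.
   Context: A Lorentzian matrix is a real symmetric matrix with nonnegative entries that has at most one positive eigenvalue; $\mathbb{L}_n^+$ is the set of $n\times n$ Lorentzian matrices with all entries positive. For a nonempty set $X$ of $n\times n$ symmetric matrices with positive entries, $\mathrm{BR}(X)$ is the set of real vectors $(\alpha_{ij})_{1\le i\le j\le n}$ for which there is $c>0$ with $\prod_{i\le j}p_{ij}^{\alpha_{ij}}\le c$ for all $(p_{ij})\in X$. If $X$ is stable under $(p_{ij})\mapsto(c_ic_jp_{ij})$ for all $(c_1,\dots,c_n)\in(\mathbb{R}_{>0})^n$, let $\underline{X}$ be the set of matrices in $X$ with all diagonal entries equal to $1$, and define $\underline{\mathrm{BR}}(X)$ as the set of real vectors $(\alpha_{ij})_{1\le i<j\le n}$ such that there is $c>0$ with $\prod_{1\le i<j\le n}p_{ij}^{\alpha_{ij}}\le c$ for all $(p_{ij})\in\underline{X}$. For $S\subseteq[n]$ the cut vector $\delta(S)\in\mathbb{R}^{\binom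 n2}$ has $\delta(S)_{ij}=1$ if $S$ contains exactly one of $i,j$ and $0$ otherwise; the cut cone $\mathrm{Cut}_n$ is the cone generated by all $\delta(S)$, $S\subseteq[n]$. *)

theory Defs
  imports "HOL-Analysis.Analysis"
begin

type_synonym 'n sqmat = "((real, 'n) vec, 'n) vec"

text \<open>
  The index set \<open>[n]\<close> is a finite linearly ordered type \<open>'n\<close>, so \<open>n = CARD('n) \<ge> 1\<close>. A vector indexed
  by the pairs \<open>i \<le> j\<close> (resp. \<open>i < j\<close>) is a matrix in \<^typ>\<open>'n sqmat\<close> whose entries at all other
  positions are 0.
\<close>

definition pairs_le :: "('n::{finite,linorder} \<times> 'n) set" where
  "pairs_le = {(i, j). i \<le> j}"

definition pairs_less :: "('n::{finite,linorder} \<times> 'n) set" where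
  "pairs_less = {(i, j). i < j}"

definition vectors_on :: "('n::finite \<times> 'n) set \<Rightarrow> 'n::finite sqmat set" where
  "vectors_on I = {\<alpha>. \<forall>i j. (i, j) \<notin> I \<longrightarrow> \<alpha> $ i $ j = 0}"


definition eigenspace :: "'n::finite sqmat \<Rightarrow> real \<Rightarrow> (real^'n) set" where
  "eigenspace A \<mu> = {v. A *v v = \<mu> *\<^sub>R v}"

text \<open>
  Eigenvalues are counted with multiplicity. The matrices of interest are symmetric, hence
  diagonalizable, so the multiplicity of an eigenvalue is the dimension of its eigenspace.
\<close>

definition num_positive_eigenvalues :: "'n::finite sqmat \<Rightarrow> nat" where
  "num_positive_eigenvalues A =
     (\<Sum>\<mu> | \<mu> > 0 \<and> (\<exists>v. v \<noteq> 0 \<and> A *v v = \<mu> *\<^sub>R v). dim (eigenspace A \<mu>))"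

definition lorentzian :: "'n::finite sqmat \<Rightarrow> bool" where
  "lorentzian A \<longleftrightarrow> transpose A = A \<and> (\<forall>i j. A $ i $ j \<ge> 0) \<and> num_positive_eigenvalues A \<le> 1"

definition pos_lorentzian :: "'n::finite sqmat set" where
  "pos_lorentzian = {A. lorentzian A \<and> (\<forall>i j. A $ i $ j > 0)}"


definition BR :: "'n::{finite,linorder} sqmat set \<Rightarrow> 'n::{finite,linorder} sqmat set" where
  "BR X = {\<alpha> \<in> vectors_on pairs_le.
     \<exists>c>0. \<forall>p\<in>X. (\<Prod>(i, j)\<in>pairs_le. (p $ i $ j) powr (\<alpha> $ i $ j)) \<le> c}"

definition unit_diagonal :: "'n::finite sqmat set \<Rightarrow> 'n::finite sqmat set" where
  "unit_diagonal X = {p \<in> X. \<forall>i. p $ i $ i = 1}"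

definition reduced_BR :: "'n::{finite,linorder} sqmat set \<Rightarrow> 'n::{finite,linorder} sqmat set" where
  "reduced_BR X = {\<alpha> \<in> vectors_on pairs_less.
     \<exists>c>0. \<forall>p\<in>unit_diagonal X. (\<Prod>(i, j)\<in>pairs_less. (p $ i $ j) powr (\<alpha> $ i $ j)) \<le> c}"


definition cut_vector :: "'n set \<Rightarrow> 'n::{finite,linorder} sqmat" where
  "cut_vector S = (\<chi> i j. if i < j \<and> (i \<in> S) \<noteq> (j \<in> S) then 1 else 0)"

definition cut_cone :: "'n::{finite,linorder} sqmat set" where
  "cut_cone = convex_cone hull (range cut_vector)"

definition integral_vector :: "'n::finite sqmat \<Rightarrow> bool" where
  "integral_vector \<alpha> \<longleftrightarrow> (\<forall>i j. \<alpha> $ i $ j \<in> \<int>)"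

end

theory Submission
  imports Defs
begin

text \<open>
  A symmetric matrix has at most one positive eigenvalue iff its quadratic form is nonpositive on some
  hyperplane. Applied to a combination of three unit vectors this gives a four-point condition
  \<open>p i j * p k l \<le> 4 * max (p i k * p j l) (p k j * p i l)\<close>, which says that the Gromov products of
  \<open>ln p\<close> are ultrametric up to the additive error \<open>ln 4\<close>. They are therefore within bounded distance of
  an exact ultrametric, whose level sets decompose the corresponding tree metric into cuts. Conversely,
  the matrix with entries \<open>t \<ge> 1\<close> across a cut and \<open>1\<close> elsewhere is Lorentzian. Rescaling adds to the cut
  inequalities one balance equation per index, so the cone of bounded ratios is cut out by finitely
  many integral inequalities, and the double description method produces integral generators.
\<close>

subsection \<open>Symmetric matrices with at most one positive eigenvalue\<close>

lemma symmetric_inner_commute: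
  fixes A :: "real^'n^'n"
  assumes "transpose A = A"
  shows "(A *v x) \<bullet> y = x \<bullet> (A *v y)"
  by (metis assms dot_lmul_matrix transpose_matrix_vector)

text \<open>First-order optimality: for small \<open>s\<close> the linear term dominates, so it must
  vanish.\<close>

lemma quadratic_nonneg_imp_linear_zero:
  fixes b c :: real
  assumes "\<And>s. 0 \<le> 2 * s * b + s\<^sup>2 * c"
  shows "b = 0"
proof -
  define D where "D = \<bar>c\<bar> + 1"
  have D: "D > 0" "c \<le> D" by (auto simp: D_def)
  \<comment> \<open>\<open>s = - b / D\<close> minimizes the quadratic in which \<open>c\<close> is
    replaced by its positive majorant \<open>D\<close>.\<close>
  have "0 \<le> 2 * (- b / D) * b + (- b / D)\<^sup>2 * c" by (rule assms)
  also have "\<dots> \<le> 2 * (- b / D) * b + (- b / D)\<^sup>2 * D"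
    using D by (intro add_left_mono mult_left_mono) auto
  also have "\<dots> = - (b\<^sup>2 / D)"
    using D by (simp add: field_simps power2_eq_square)
  finally have "b\<^sup>2 / D \<le> 0" by simp
  then show ?thesis using D by (simp add: divide_le_0_iff)
qed

text \<open>A maximizer of the form on the compact unit sphere of \<open>U\<close> works: invariance
  keeps the gradient there inside \<open>U\<close>, and maximality kills it.\<close>

lemma symmetric_max_eigenvector:
  fixes A :: "real^'n^'n"
  assumes sym: "transpose A = A" and U: "subspace U" "\<And>x. x \<in> U \<Longrightarrow> A *v x \<in> U"
    and nz: "\<exists>x\<in>U. x \<noteq> 0"
  obtains e \<mu> where "e \<in> U" "norm e = 1" "A *v e = \<mu> *\<^sub>R e"
    "\<And>x. x \<in> U \<Longrightarrow> x \<bullet> (A *v x) \<le> \<mu> * (x \<bullet> x)"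
proof -
  obtain z where z: "z \<in> U" "z \<noteq> 0" using nz by blast
  have "compact (sphere 0 1 \<inter> U)"
    using U(1) by (simp add: closed_subspace compact_Int_closed)
  moreover have "z /\<^sub>R norm z \<in> sphere 0 1 \<inter> U"
    using z U(1) by (simp add: subspace_scale)
  moreover have "continuous_on (sphere 0 1 \<inter> U) (\<lambda>x. x \<bullet> (A *v x))"
    by (intro continuous_intros linear_continuous_on matrix_vector_mul_bounded_linear)
  ultimately obtain e where e: "e \<in> sphere 0 1 \<inter> U"
    and max: "\<And>y. y \<in> sphere 0 1 \<inter> U \<Longrightarrow> y \<bullet> (A *v y) \<le> e \<bullet> (A *v e)"
    using continuous_attains_sup[of "sphere 0 1 \<inter> U" "\<lambda>x. x \<bullet> (A *v x)"] by blast
  define \<mu> where "\<mu> = e \<bullet> (A *v e)"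
  have ee: "e \<in> U" "norm e = 1" "e \<bullet> e = 1" using e by (auto simp: dot_square_norm)
  have bound: "x \<bullet> (A *v x) \<le> \<mu> * (x \<bullet> x)" if "x \<in> U" for x
  proof (cases "x = 0")
    case False
    let ?y = "x /\<^sub>R norm x"
    have "?y \<in> sphere 0 1 \<inter> U" using False that U(1) by (simp add: subspace_scale)
    from max[OF this] have "(x \<bullet> (A *v x)) / (norm x)\<^sup>2 \<le> \<mu>"
      by (simp add: \<mu>_def matrix_vector_mult_scaleR power2_eq_square divide_simps)
    then show ?thesis using False
      by (simp add: divide_le_eq dot_square_norm)
  qed simp
  \<comment> \<open>\<open>y\<close> is half the gradient at \<open>e\<close> of
    \<open>\<mu> * (x \<bullet> x) - x \<bullet> (A *v x)\<close>, a form that is nonnegative on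
    \<open>U\<close> and vanishes at \<open>e\<close>. Moving from \<open>e\<close> along
    \<open>y\<close> gives \<open>y = 0\<close>.\<close>
  define y where "y = \<mu> *\<^sub>R e - A *v e"
  have yU: "y \<in> U" unfolding y_def by (intro subspace_diff subspace_scale U ee)
  have comm: "e \<bullet> (A *v y) = y \<bullet> (A *v e)"
    by (metis inner_commute sym symmetric_inner_commute)
  have "y \<bullet> y = \<mu> * (e \<bullet> y) - y \<bullet> (A *v e)"
    by (subst (2) y_def) (simp add: inner_diff_right inner_commute)
  then have yAe: "y \<bullet> (A *v e) = \<mu> * (e \<bullet> y) - y \<bullet> y" by simp
  have "0 \<le> 2 * s * (y \<bullet> y) + s\<^sup>2 * (\<mu> * (y \<bullet> y) - y \<bullet> (A *v y))" for s
  proof -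
    have "e + s *\<^sub>R y \<in> U" by (intro subspace_add subspace_scale U ee yU)
    from bound[OF this]
    have "\<mu> + s * (y \<bullet> (A *v e)) * 2 + s\<^sup>2 * (y \<bullet> (A *v y))
            \<le> \<mu> * (1 + 2 * s * (e \<bullet> y) + s\<^sup>2 * (y \<bullet> y))"
      by (simp add: matrix_vector_right_distrib matrix_vector_mult_scaleR inner_add_left
          inner_add_right \<mu>_def[symmetric] ee comm inner_commute[of y e] power2_eq_square algebra_simps)
    then show ?thesis unfolding yAe by (simp add: algebra_simps)
  qed
  then have "y \<bullet> y = 0" by (rule quadratic_nonneg_imp_linear_zero)
  then have "A *v e = \<mu> *\<^sub>R e" by (simp add: y_def)
  with ee bound that show ?thesis by blast
qed

lemma symmetric_eigenvectors_orthogonal: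
  fixes A :: "real^'n^'n"
  assumes "transpose A = A" "A *v u = \<mu> *\<^sub>R u" "A *v v = \<nu> *\<^sub>R v" "\<mu> \<noteq> \<nu>"
  shows "u \<bullet> v = 0"
proof -
  have "\<mu> * (u \<bullet> v) = \<nu> * (u \<bullet> v)"
    using symmetric_inner_commute[OF assms(1), of u v] assms by simp
  then show ?thesis using assms(4) by simp
qed

text \<open>One eigenvector per eigenvalue yields an orthogonal, hence independent, family.
  Finiteness makes the sum in \<open>num_positive_eigenvalues\<close> a genuine count.\<close>

lemma finite_eigenvalues_symmetric:
  fixes A :: "real^'n^'n"
  assumes "transpose A = A"
  shows "finite {\<mu>. \<exists>v. v \<noteq> 0 \<and> A *v v = \<mu> *\<^sub>R v}" (is "finite ?E")
proof -
  obtain f where f: "\<And>\<mu>. \<mu> \<in> ?E \<Longrightarrow> f \<mu> \<noteq> 0 \<and> A *v f \<mu> = \<mu> *\<^sub>R f \<mu>"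
    using bchoice[of ?E "\<lambda>\<mu> v. v \<noteq> 0 \<and> A *v v = \<mu> *\<^sub>R v"] by auto
  have "inj_on f ?E"
    by (rule inj_onI) (metis (no_types, lifting) f scaleR_right_imp_eq)
  moreover have "pairwise orthogonal (f ` ?E)"
    unfolding pairwise_def orthogonal_def
    by (smt (verit, ccfv_SIG) assms f image_iff symmetric_eigenvectors_orthogonal)
  then have "independent (f ` ?E)"
    using f by (intro pairwise_orthogonal_independent) (auto, blast)
  then have "finite (f ` ?E)" by (simp add: independent_bound)
  ultimately show ?thesis using finite_image_iff by blast
qed

text \<open>Two orthogonal eigenvectors contribute 2 to one eigenspace or 1 to each of two.\<close>

lemma num_positive_eigenvalues_ge_2:
  fixes A :: "real^'n^'n"
  assumes sym: "transpose A = A" and u: "A *v u = \<mu> *\<^sub>R u" "u \<noteq> 0" "\<mu> > 0"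
    and v: "A *v v = \<nu> *\<^sub>R v" "v \<noteq> 0" "\<nu> > 0" and "u \<bullet> v = 0"
  shows "num_positive_eigenvalues A \<ge> 2"
proof -
  let ?E = "{\<mu>. \<mu> > 0 \<and> (\<exists>v. v \<noteq> 0 \<and> A *v v = \<mu> *\<^sub>R v)}"
  have fin: "finite ?E"
    by (rule finite_subset[OF _ finite_eigenvalues_symmetric[OF sym]]) auto
  have mem: "\<mu> \<in> ?E" "\<nu> \<in> ?E" using u v by auto
  have ind: "independent S" if "S \<subseteq> {u, v}" for S
  proof (rule pairwise_orthogonal_independent)
    show "pairwise orthogonal S"
      using that assms(8) unfolding pairwise_def orthogonal_def
      by (metis (no_types, lifting) inner_commute insertE singletonD subsetD)
  qed (use that u v in auto)
  have card_le: "card S \<le> dim (eigenspace A \<kappa>)" if "S \<subseteq> {u, v}" "S \<subseteq> eigenspace A \<kappa>" for S \<kappa>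
    using ind[OF that(1)] that(2) by (metis dim_eq_card_independent dim_subset)
  show ?thesis
  proof (cases "\<mu> = \<nu>")
    case True
    have "u \<noteq> v" using assms(8) u by auto
    then have "2 \<le> dim (eigenspace A \<mu>)"
      using card_le[of "{u, v}" \<mu>] u v True by (simp add: eigenspace_def)
    also have "\<dots> \<le> (\<Sum>\<mu>\<in>?E. dim (eigenspace A \<mu>))"
      by (rule member_le_sum[OF mem(1) _ fin]) simp
    finally show ?thesis by (simp add: num_positive_eigenvalues_def)
  next
    case False
    have "1 \<le> dim (eigenspace A \<mu>)" "1 \<le> dim (eigenspace A \<nu>)"
      using card_le[of "{u}" \<mu>] card_le[of "{v}" \<nu>] u v by (simp_all add: eigenspace_def)
    then have "2 \<le> (\<Sum>\<mu>\<in>{\<mu>, \<nu>}. dim (eigenspace A \<mu>))" using False by simp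
    also have "\<dots> \<le> (\<Sum>\<mu>\<in>?E. dim (eigenspace A \<mu>))"
      by (rule sum_mono2[OF fin]) (use mem in auto)
    finally show ?thesis by (simp add: num_positive_eigenvalues_def)
  qed
qed

text \<open>Forwards, \<open>w\<close> is an eigenvector for the largest eigenvalue. Backwards, any
  two eigenvectors with positive eigenvalues have a combination in the hyperplane of
  \<open>w\<close>, which forces them to be proportional.\<close>

lemma num_positive_eigenvalues_le_1_iff:
  fixes A :: "real^'n^'n"
  assumes sym: "transpose A = A"
  shows "num_positive_eigenvalues A \<le> 1 \<longleftrightarrow> (\<exists>w. \<forall>x. w \<bullet> x = 0 \<longrightarrow> x \<bullet> (A *v x) \<le> 0)"
    (is "?lhs \<longleftrightarrow> ?rhs")
proof
  assume ?lhs
  have "\<exists>x::real^'n. x \<noteq> 0" by (metis axis_eq_0_iff zero_neq_one)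
  then obtain e \<mu> where e: "norm e = 1" "A *v e = \<mu> *\<^sub>R e"
    and \<mu>: "\<And>x. x \<bullet> (A *v x) \<le> \<mu> * (x \<bullet> x)"
    using symmetric_max_eigenvector[OF sym, of UNIV] by auto
  have e0: "e \<noteq> 0" using e by auto
  have "x \<bullet> (A *v x) \<le> 0" if x: "e \<bullet> x = 0" for x
  proof (cases "\<mu> \<le> 0 \<or> x = 0")
    case True
    then show ?thesis
      using \<mu>[of x] by (auto simp: mult_nonpos_nonneg intro: order_trans)
  next
    case False
    \<comment> \<open>Now \<open>\<mu> > 0\<close> and the complement of \<open>e\<close> is a
      nonzero invariant subspace; a positive maximum \<open>\<nu>\<close> on it would be a second
      positive eigenvalue.\<close>
    let ?U = "{x. e \<bullet> x = 0}"
    have inv: "A *v y \<in> ?U" if "y \<in> ?U" for y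
      using that symmetric_inner_commute[OF sym, of e y] e by simp
    obtain f \<nu> where f: "f \<in> ?U" "norm f = 1" "A *v f = \<nu> *\<^sub>R f"
      and \<nu>: "\<And>x. x \<in> ?U \<Longrightarrow> x \<bullet> (A *v x) \<le> \<nu> * (x \<bullet> x)"
      using symmetric_max_eigenvector[OF sym subspace_hyperplane[of e] inv] False x by blast
    have "\<nu> \<le> 0"
    proof (rule ccontr)
      assume "\<not> \<nu> \<le> 0"
      then have "num_positive_eigenvalues A \<ge> 2"
        using num_positive_eigenvalues_ge_2[OF sym e(2) e0 _ f(3)] f False by force
      with \<open>?lhs\<close> show False by simp
    qed
    then show ?thesis
      using \<nu>[of x] x by (auto simp: mult_nonpos_nonneg intro: order_trans)
  qed
  then show ?rhs by blast
next
  assume ?rhs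
  then obtain w where w: "\<And>x. w \<bullet> x = 0 \<Longrightarrow> x \<bullet> (A *v x) \<le> 0" by blast
  let ?E = "{\<mu>. \<mu> > 0 \<and> (\<exists>v. v \<noteq> 0 \<and> A *v v = \<mu> *\<^sub>R v)}"
  have wnz: "w \<bullet> u \<noteq> 0" if "A *v u = \<mu> *\<^sub>R u" "u \<noteq> 0" "\<mu> > 0" for u \<mu>
    using w[of u] that by (auto simp: mult_le_0_iff simp flip: not_less)
  have dep: "(w \<bullet> v) *\<^sub>R u = (w \<bullet> u) *\<^sub>R v \<and> \<mu> = \<nu>"
    if u: "A *v u = \<mu> *\<^sub>R u" "u \<noteq> 0" "\<mu> > 0" and v: "A *v v = \<nu> *\<^sub>R v" "v \<noteq> 0" "\<nu> > 0"
    for u v \<mu> \<nu>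
  proof -
    let ?c = "w \<bullet> v" and ?d = "w \<bullet> u"
    \<comment> \<open>For distinct eigenvalues \<open>u\<close> and \<open>v\<close> are orthogonal
      and the form is positive at \<open>?x\<close>, a contradiction. For equal ones the form at
      \<open>?x\<close> is \<open>\<mu>\<close> times its squared norm, so
      \<open>?x = 0\<close>.\<close>
    let ?x = "?c *\<^sub>R u - ?d *\<^sub>R v"
    have "w \<bullet> ?x = 0" by (simp add: inner_diff_right)
    then have le: "?x \<bullet> (A *v ?x) \<le> 0" by (rule w)
    have eq: "\<mu> = \<nu>"
    proof (rule ccontr)
      assume "\<mu> \<noteq> \<nu>"
      then have uv: "u \<bullet> v = 0" using symmetric_eigenvectors_orthogonal[OF sym u(1) v(1)] by simp
      have "?x \<bullet> (A *v ?x) = ?c\<^sup>2 * (\<mu> * (u \<bullet> u)) + ?d\<^sup>2 * (\<nu> * (v \<bullet> v))"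
        using uv by (simp add: matrix_vector_mult_diff_distrib matrix_vector_mult_scaleR u v
            inner_diff_left inner_diff_right inner_commute power2_eq_square algebra_simps)
      moreover have "0 < ?c\<^sup>2 * (\<mu> * (u \<bullet> u))" "0 < ?d\<^sup>2 * (\<nu> * (v \<bullet> v))"
        using wnz[OF u] wnz[OF v] u v by (auto intro!: mult_pos_pos)
      ultimately show False using le by linarith
    qed
    have "?x \<bullet> (A *v ?x) = \<mu> * (?x \<bullet> ?x)"
      using eq by (simp add: matrix_vector_mult_diff_distrib matrix_vector_mult_scaleR u v
          inner_diff_left inner_diff_right algebra_simps)
    with le u have "?x \<bullet> ?x \<le> 0" by (simp add: mult_le_0_iff)
    then have "?x = 0" by (metis inner_gt_zero_iff not_less)
    with eq show ?thesis by simp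
  qed
  show ?lhs
  proof (cases "?E = {}")
    case True
    then show ?thesis unfolding num_positive_eigenvalues_def by (metis le_zero_eq linear sum.empty)
  next
    case False
    then obtain \<mu> u where u: "A *v u = \<mu> *\<^sub>R u" "u \<noteq> 0" "\<mu> > 0" by blast
    then have E: "?E = {\<mu>}" using dep by blast
    have "eigenspace A \<mu> \<subseteq> span {u}"
    proof
      fix v assume "v \<in> eigenspace A \<mu>"
      then have v: "A *v v = \<mu> *\<^sub>R v" by (simp add: eigenspace_def)
      show "v \<in> span {u}"
      proof (cases "v = 0")
        case False
        have "v = ((w \<bullet> v) / (w \<bullet> u)) *\<^sub>R u"
          using dep[OF u v False u(3)] wnz[OF u]
          by (metis divideR_right divide_inverse_commute scaleR_scaleR)
        then show ?thesis by (metis insertI1 span_base span_scale)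
      qed (simp add: span_zero)
    qed
    then have "dim (eigenspace A \<mu>) \<le> card {u}" by (intro dim_le_card) auto
    then show ?thesis unfolding num_positive_eigenvalues_def E by simp
  qed
qed

subsection \<open>Generators of polyhedral cones\<close>

text \<open>The nonnegative combinations of \<open>G\<close> already form a convex cone containing
  \<open>G\<close>.\<close>

lemma convex_cone_hull_finite:
  assumes "finite G" "x \<in> convex_cone hull G"
  obtains u where "\<And>g. g \<in> G \<Longrightarrow> 0 \<le> u g" "x = (\<Sum>g\<in>G. u g *\<^sub>R g)"
proof -
  let ?K = "{x. \<exists>u. (\<forall>g\<in>G. 0 \<le> u g) \<and> x = (\<Sum>g\<in>G. u g *\<^sub>R g)}"
  have "convex_cone hull G \<subseteq> ?K"
  proof (rule hull_minimal)
    show "G \<subseteq> ?K"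
    proof
      fix h assume "h \<in> G"
      then have "h = (\<Sum>g\<in>G. (if g = h then 1 else 0) *\<^sub>R g)"
        using assms(1) by (simp add: if_distrib[of "\<lambda>c. c *\<^sub>R _"] sum.delta cong: if_cong)
      then show "h \<in> ?K" by (intro CollectI exI[of _ "\<lambda>g. if g = h then 1 else 0"]) simp
    qed
    have "x + y \<in> ?K" if xy: "x \<in> ?K" "y \<in> ?K" for x y
    proof -
      obtain u v where "\<forall>g\<in>G. 0 \<le> u g" "x = (\<Sum>g\<in>G. u g *\<^sub>R g)"
        "\<forall>g\<in>G. 0 \<le> v g" "y = (\<Sum>g\<in>G. v g *\<^sub>R g)" 
        using xy by (elim CollectE exE conjE)
      then show ?thesis
        by (intro CollectI exI[of _ "\<lambda>g. u g + v g"]) (simp add: scaleR_left_distrib sum.distrib)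
    qed
    moreover have "c *\<^sub>R x \<in> ?K" if x: "x \<in> ?K" and "0 \<le> c" for x c
    proof -
      obtain u where "\<forall>g\<in>G. 0 \<le> u g" "x = (\<Sum>g\<in>G. u g *\<^sub>R g)" 
        using x by (elim CollectE exE conjE)
      with \<open>0 \<le> c\<close> show ?thesis
        by (intro CollectI exI[of _ "\<lambda>g. c * u g"]) (simp add: scaleR_sum_right)
    qed
    moreover have "0 \<in> ?K" by (intro CollectI exI[of _ "\<lambda>g. 0"]) simp
    ultimately show "convex_cone ?K" unfolding convex_cone_iff by (intro conjI ballI allI impI)
  qed
  with assms(2) have "x \<in> ?K" by (rule subsetD[rotated])
  then show ?thesis by (elim CollectE exE conjE) (rule that, simp_all)
qed

lemma convex_cone_hull_sum:
  assumes "\<And>g. g \<in> S \<Longrightarrow> 0 \<le> u g \<and> f g \<in> G"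
  shows "(\<Sum>g\<in>S. u g *\<^sub>R f g) \<in> convex_cone hull G"
  using assms
  by (induction S rule: infinite_finite_induct)
    (simp_all add: convex_cone_hull_add convex_cone_hull_mul hull_inc convex_cone_hull_contains_0)

text \<open>One step of the double description method: pairing each generator on the positive side with
  each one on the negative side gives the new generators on the hyperplane.\<close>

lemma convex_cone_hull_Int_halfspace:
  fixes a :: "'a::euclidean_space"
  assumes fin: "finite G"
  defines "P \<equiv> {g\<in>G. a \<bullet> g > 0}" and "N \<equiv> {g\<in>G. a \<bullet> g \<le> 0}"
  shows "convex_cone hull G \<inter> {x. a \<bullet> x \<le> 0} =
    convex_cone hull (N \<union> (\<lambda>(g, h). (a \<bullet> g) *\<^sub>R h - (a \<bullet> h) *\<^sub>R g) ` (P \<times> N))"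
    (is "_ = convex_cone hull (N \<union> ?f ` _)")
proof
  let ?G' = "N \<union> ?f ` (P \<times> N)"
  show "convex_cone hull ?G' \<subseteq> convex_cone hull G \<inter> {x. a \<bullet> x \<le> 0}"
  proof (rule hull_minimal)
    have "?f (g, h) \<in> convex_cone hull G" if "g \<in> P" "h \<in> N" for g h
    proof -
      have "(a \<bullet> g) *\<^sub>R h + (- (a \<bullet> h)) *\<^sub>R g \<in> convex_cone hull G"
        using that by (intro convex_cone_hull_add convex_cone_hull_mul hull_inc) (auto simp: P_def N_def)
      then show ?thesis by simp
    qed
    moreover have "a \<bullet> ?f (g, h) = 0" for g h by (simp add: inner_diff_right)
    ultimately show "?G' \<subseteq> convex_cone hull G \<inter> {x. a \<bullet> x \<le> 0}"
      by (auto simp: N_def hull_inc)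
    show "convex_cone (convex_cone hull G \<inter> {x. a \<bullet> x \<le> 0})"
      using convex_cone_convex_cone_hull[of G] convex_cone_halfspace_le[of a]
      by (simp only: convex_cone_iff) blast
  qed
  show "convex_cone hull G \<inter> {x. a \<bullet> x \<le> 0} \<subseteq> convex_cone hull ?G'"
  proof
    fix x assume "x \<in> convex_cone hull G \<inter> {x. a \<bullet> x \<le> 0}"
    then have ax: "a \<bullet> x \<le> 0" and "x \<in> convex_cone hull G" by auto
    then obtain u where u: "\<And>g. g \<in> G \<Longrightarrow> 0 \<le> u g" and x: "x = (\<Sum>g\<in>G. u g *\<^sub>R g)"
      using convex_cone_hull_finite[OF fin] by metis
    have G: "G = P \<union> N" "P \<inter> N = {}" "finite P" "finite N"
      using fin by (auto simp: P_def N_def)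
    have xPN: "x = (\<Sum>g\<in>P. u g *\<^sub>R g) + (\<Sum>h\<in>N. u h *\<^sub>R h)"
      unfolding x G(1) using G(2-4) by (rule sum.union_disjoint[rotated 2])
    \<comment> \<open>\<open>a \<bullet> x = p - n\<close>, split into the contributions of the two
      sides.\<close>
    define p where "p = (\<Sum>g\<in>P. u g * (a \<bullet> g))"
    define n where "n = (\<Sum>h\<in>N. u h * - (a \<bullet> h))"
    have pn: "p \<le> n"
      using ax unfolding xPN p_def n_def
      by (simp add: inner_add_right inner_sum_right sum_negf)
    have uP: "g \<in> P \<Longrightarrow> 0 \<le> u g \<and> a \<bullet> g > 0" and uN: "h \<in> N \<Longrightarrow> 0 \<le> u h \<and> a \<bullet> h \<le> 0" for g h
      using u by (auto simp: P_def N_def)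
    have p0: "0 \<le> p" unfolding p_def using uP by (intro sum_nonneg) (simp add: less_imp_le)
    show "x \<in> convex_cone hull ?G'"
    proof (cases "p = 0")
      case True
      then have "\<forall>g\<in>P. u g * (a \<bullet> g) = 0"
        unfolding p_def by (subst (asm) sum_nonneg_eq_0_iff) (use G uP in \<open>auto simp: less_imp_le\<close>)
      then have "\<forall>g\<in>P. u g = 0" using uP by fastforce
      then have "x = (\<Sum>h\<in>N. u h *\<^sub>R h)" using xPN by simp
      then show ?thesis using uN convex_cone_hull_sum[of N u "\<lambda>h. h" ?G'] by auto
    next
      case False
      then have n0: "n > 0" using p0 pn by simp
      \<comment> \<open>With these weights the paired generators reproduce the whole
        \<open>P\<close> part of \<open>x\<close> and the fraction \<open>p / n\<close> of its
        \<open>N\<close> part; \<open>?t\<close> is the remaining fraction of the \<open>N\<close>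
        part.\<close>
      let ?s = "\<Sum>z\<in>P\<times>N. (u (fst z) * u (snd z) / n) *\<^sub>R ?f z"
      let ?t = "\<Sum>h\<in>N. (u h * (1 - p / n)) *\<^sub>R h"
      have "?s = (\<Sum>g\<in>P. \<Sum>h\<in>N. (u g * (a \<bullet> g)) *\<^sub>R (u h / n) *\<^sub>R h + (u h * - (a \<bullet> h)) *\<^sub>R (u g / n) *\<^sub>R g)"
        unfolding sum.cartesian_product
        by (intro sum.cong) (auto simp: scaleR_diff_right mult_ac)
      also have "\<dots> = p *\<^sub>R (\<Sum>h\<in>N. (u h / n) *\<^sub>R h) + (\<Sum>g\<in>P. n *\<^sub>R (u g / n) *\<^sub>R g)"
        unfolding sum.distrib p_def n_def scaleR_sum_left scaleR_sum_right
        by (intro arg_cong2[of _ _ _ _ "(+)"] refl) (rule sum.swap)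
      also have "(\<Sum>g\<in>P. n *\<^sub>R (u g / n) *\<^sub>R g) = (\<Sum>g\<in>P. u g *\<^sub>R g)" using n0 by simp
      also have "p *\<^sub>R (\<Sum>h\<in>N. (u h / n) *\<^sub>R h) = (\<Sum>h\<in>N. u h *\<^sub>R h) - ?t"
        unfolding sum_subtractf[symmetric] scaleR_sum_right
        by (intro sum.cong) (simp_all add: algebra_simps)
      finally have "x = ?s + ?t" using xPN by simp
      moreover have "?s \<in> convex_cone hull ?G'"
        by (rule convex_cone_hull_sum) (use uP uN n0 in auto)
      moreover have "?t \<in> convex_cone hull ?G'"
        using uN n0 pn by (intro convex_cone_hull_sum) auto
      ultimately show ?thesis by (simp add: convex_cone_hull_add)
    qed
  qed
qed

section \<open>Integrality of the generators\<close>

lemma integral_vector_inner: "integral_vector a \<Longrightarrow> integral_vector b \<Longrightarrow> a \<bullet> b \<in> \<int>"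
  unfolding integral_vector_def inner_vec_def by (auto intro!: Ints_sum Ints_mult)

lemma integral_vector_uminus: "integral_vector a \<Longrightarrow> integral_vector (- a)"
  by (simp add: integral_vector_def)

lemma integral_vector_diff: "integral_vector a \<Longrightarrow> integral_vector b \<Longrightarrow> integral_vector (a - b)"
  by (simp add: integral_vector_def)

lemma integral_vector_scaleR: "c \<in> \<int> \<Longrightarrow> integral_vector a \<Longrightarrow> integral_vector (c *\<^sub>R a)"
  by (simp add: integral_vector_def)

lemma integral_vector_Basis: "b \<in> Basis \<Longrightarrow> integral_vector b"
  unfolding Basis_vec_def by (elim UN_E imageE) (auto simp: integral_vector_def axis_def)

text \<open>Half-spaces are added one at a time, starting from the full space. The new generators
  stay integral because their coefficients are inner products of integral vectors.\<close>

lemma integral_generators: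
  fixes F :: "'n::finite sqmat set"
  assumes "finite F" "\<And>a. a \<in> F \<Longrightarrow> integral_vector a"
  shows "\<exists>G. finite G \<and> (\<forall>g\<in>G. integral_vector g) \<and> {x. \<forall>a\<in>F. a \<bullet> x \<le> 0} = convex_cone hull G"
  using assms
proof (induction F)
  case empty
  let ?G = "Basis \<union> uminus ` Basis :: 'n sqmat set"
  have "x \<in> convex_cone hull ?G" for x :: "'n sqmat"
  proof -
    \<comment> \<open>The sign of each coordinate selects \<open>b\<close> or \<open>- b\<close>, so
      that all weights are nonnegative.\<close>
    have "(\<Sum>b\<in>Basis. \<bar>x \<bullet> b\<bar> *\<^sub>R (if x \<bullet> b \<ge> 0 then b else - b)) \<in> convex_cone hull ?G"
      by (rule convex_cone_hull_sum) auto
    also have "(\<Sum>b\<in>Basis. \<bar>x \<bullet> b\<bar> *\<^sub>R (if x \<bullet> b \<ge> 0 then b else - b)) = x"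
      by (subst (3) euclidean_representation[symmetric], intro sum.cong) auto
    finally show ?thesis .
  qed
  then show ?case
    by (intro exI[of _ ?G]) (auto simp: integral_vector_Basis integral_vector_uminus)
next
  case (insert a F)
  then obtain G where G: "finite G" "\<And>g. g \<in> G \<Longrightarrow> integral_vector g"
    "{x. \<forall>a\<in>F. a \<bullet> x \<le> 0} = convex_cone hull G" by auto
  let ?P = "{g\<in>G. a \<bullet> g > 0}" and ?N = "{g\<in>G. a \<bullet> g \<le> 0}"
  let ?G = "?N \<union> (\<lambda>(g, h). (a \<bullet> g) *\<^sub>R h - (a \<bullet> h) *\<^sub>R g) ` (?P \<times> ?N)"
  have "{x. \<forall>b\<in>insert a F. b \<bullet> x \<le> 0} = convex_cone hull G \<inter> {x. a \<bullet> x \<le> 0}"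
    using G(3) by auto
  also have "\<dots> = convex_cone hull ?G" by (rule convex_cone_hull_Int_halfspace[OF G(1)])
  finally have "{x. \<forall>b\<in>insert a F. b \<bullet> x \<le> 0} = convex_cone hull ?G" .
  moreover have "\<forall>g\<in>?G. integral_vector g"
    using G(2) insert.prems by (auto intro!: integral_vector_diff integral_vector_scaleR integral_vector_inner)
  moreover have "finite ?G" using G(1) by auto
  ultimately show ?case by (intro exI[of _ ?G] conjI)
qed

subsection \<open>Quasi-ultrametrics and cuts\<close>

text \<open>\<open>E\<close> is a partial equivalence relation: a point of its domain lies in
  exactly one class, any other point in none. The indicator of being separated by \<open>C\<close>
  is the sum of the two membership indicators minus twice their product.\<close>

lemma sum_separating_classes:
  fixes E :: "('n::finite \<times> 'n) set"
  assumes "sym E" "trans E"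
  shows "(\<Sum>C\<in>range (\<lambda>k. E `` {k}). of_bool ((i \<in> C) \<noteq> (j \<in> C)) :: real) =
    of_bool ((i, i) \<in> E) + of_bool ((j, j) \<in> E) - 2 * of_bool ((i, j) \<in> E)"
proof -
  let ?R = "range (\<lambda>k. E `` {k})"
  have mem: "i \<in> C \<longleftrightarrow> (i, i) \<in> E \<and> C = E `` {i}" if "C \<in> ?R" for C i
    using that assms unfolding sym_def trans_def by blast
  have single: "(\<Sum>C\<in>?R. of_bool (P \<and> C = E `` {i}) :: real) = of_bool P" for P i
    by (cases P) (simp_all add: of_bool_def sum.delta)
  have "(\<Sum>C\<in>?R. of_bool ((i \<in> C) \<noteq> (j \<in> C)) :: real) =
      (\<Sum>C\<in>?R. of_bool ((i, i) \<in> E \<and> C = E `` {i}) + of_bool ((j, j) \<in> E \<and> C = E `` {j})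
        - 2 * of_bool ((i, j) \<in> E \<and> C = E `` {i}))"
  proof (intro sum.cong refl)
    fix C assume C: "C \<in> ?R"
    have "i \<in> C \<and> j \<in> C \<longleftrightarrow> (i, j) \<in> E \<and> C = E `` {i}"
      using mem[OF C, of i] mem[OF C, of j] assms unfolding sym_def trans_def by blast
    then show "of_bool ((i \<in> C) \<noteq> (j \<in> C)) =
        of_bool ((i, i) \<in> E \<and> C = E `` {i}) + of_bool ((j, j) \<in> E \<and> C = E `` {j})
        - 2 * (of_bool ((i, j) \<in> E \<and> C = E `` {i}) :: real)"
      unfolding mem[OF C, of i, symmetric] mem[OF C, of j, symmetric]
      by (simp flip: \<open>i \<in> C \<and> j \<in> C \<longleftrightarrow> (i, j) \<in> E \<and> C = E `` {i}\<close>)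
  qed
  also have "\<dots> = of_bool ((i, i) \<in> E) + of_bool ((j, j) \<in> E) - 2 * of_bool ((i, j) \<in> E)"
    unfolding sum.distrib sum_subtractf sum_distrib_left[symmetric] single ..
  finally show ?thesis .
qed

text \<open>Truncating the largest value of \<open>g\<close> to the second largest one changes the left-hand side by a
  multiple of a sum over cuts, one for each class of the partial equivalence relation on which \<open>g\<close>
  attains its maximum.\<close>

lemma ultrametric_sum_nonpos:
  fixes g :: "'n::finite \<Rightarrow> 'n \<Rightarrow> real"
  assumes cut: "\<And>S. (\<Sum>(i, j)\<in>I. a i j * of_bool ((i \<in> S) \<noteq> (j \<in> S))) \<le> 0"
    and sym: "\<And>i j. g i j = g j i" and ultra: "\<And>i j k. min (g i k) (g k j) \<le> g i j"
  shows "(\<Sum>(i, j)\<in>I. a i j * (g i i + g j j - 2 * g i j)) \<le> 0"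
  using sym ultra
\<comment> \<open>Induction on the number of values of \<open>g\<close>; a constant \<open>g\<close>
  makes every term 0.\<close>
proof (induction "card (range (case_prod g))" arbitrary: g rule: less_induct)
  case less
  let ?V = "range (case_prod g)"
  define M where "M = Max ?V"
  have mem: "g i j \<in> ?V" for i j by (metis case_prod_conv rangeI)
  have le_M: "g i j \<le> M" for i j unfolding M_def using mem by simp
  have M: "M \<in> ?V" unfolding M_def by (rule Max_in) auto
  show ?case
  proof (cases "?V = {M}")
    case True
    then have "g i j = M" for i j using mem[of i j] by simp
    then show ?thesis by simp
  next
    case False
    define m where "m = Max (?V - {M})"
    have ne: "?V - {M} \<noteq> {}" using False M by blast
    have m: "m \<in> ?V - {M}" unfolding m_def using ne by (intro Max_in) auto
    then obtain i j where "m = g i j" "m \<noteq> M" by auto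
    then have "m < M" using le_M[of i j] by simp
    have le_m: "g i j = M \<or> g i j \<le> m" for i j
      unfolding m_def using mem[of i j] by (metis DiffI Max_ge finite finite_Diff finite_imageI singletonD)
    \<comment> \<open>Truncation removes the value \<open>M\<close> and creates no new value, so the
      induction hypothesis applies to \<open>h\<close>.\<close>
    define h where "h i j = min (g i j) m" for i j
    define E where "E = {(i, j). g i j = M}"
    have gh: "g i j = h i j + (M - m) * of_bool ((i, j) \<in> E)" for i j
      using le_m[of i j] \<open>m < M\<close> by (auto simp: h_def E_def)
    have "range (case_prod h) \<subseteq> ?V - {M}"
    proof
      fix x assume "x \<in> range (case_prod h)"
      then obtain i j where "x = min (g i j) m" by (auto simp: h_def)
      then show "x \<in> ?V - {M}" using m mem[of i j] \<open>m < M\<close> by (auto simp: min_def)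
    qed
    then have "card (range (case_prod h)) \<le> card (?V - {M})" by (intro card_mono) auto
    also have "\<dots> < card ?V" using M by (intro card_Diff1_less) auto
    finally have card: "card (range (case_prod h)) < card ?V" .
    have hsum: "(\<Sum>(i, j)\<in>I. a i j * (h i i + h j j - 2 * h i j)) \<le> 0"
    proof (rule less.hyps[OF card])
      show "h i j = h j i" for i j using less.prems(1) by (simp add: h_def)
      show "min (h i k) (h k j) \<le> h i j" for i j k
        using less.prems(2)[of i k j] by (auto simp: h_def min_le_iff_disj)
    qed
    have E: "sym E" "trans E"
    proof -
      show "sym E" using less.prems(1) by (auto simp: sym_def E_def)
      \<comment> \<open>Transitivity of \<open>E\<close> is the ultrametric inequality at the
        maximal value.\<close>
      have "g i k = M" if "g i j = M" "g j k = M" for i j k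
        using less.prems(2)[of i j k] le_M[of i k] that by simp
      then show "trans E" by (auto simp: trans_def E_def)
    qed
    let ?e = "\<lambda>i j. of_bool ((i, i) \<in> E) + of_bool ((j, j) \<in> E) - 2 * (of_bool ((i, j) \<in> E) :: real)"
    have "(\<Sum>(i, j)\<in>I. a i j * ?e i j) =
        (\<Sum>(i, j)\<in>I. \<Sum>C\<in>range (\<lambda>k. E `` {k}). a i j * of_bool ((i \<in> C) \<noteq> (j \<in> C)))"
      unfolding sum_separating_classes[OF E, symmetric] sum_distrib_left ..
    also have "\<dots> = (\<Sum>C\<in>range (\<lambda>k. E `` {k}). \<Sum>(i, j)\<in>I. a i j * of_bool ((i \<in> C) \<noteq> (j \<in> C)))"
      unfolding case_prod_unfold by (rule sum.swap)
    also have "\<dots> \<le> 0" by (intro sum_nonpos cut)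
    finally have esum: "(\<Sum>(i, j)\<in>I. a i j * ?e i j) \<le> 0" .
    have "(\<Sum>(i, j)\<in>I. a i j * (g i i + g j j - 2 * g i j)) =
        (\<Sum>(i, j)\<in>I. a i j * (h i i + h j j - 2 * h i j)) + (M - m) * (\<Sum>(i, j)\<in>I. a i j * ?e i j)"
      unfolding sum_distrib_left sum.distrib[symmetric]
      by (intro sum.cong refl) (simp add: gh case_prod_unfold algebra_simps)
    also have "\<dots> \<le> 0"
      using hsum esum \<open>m < M\<close> by (intro add_nonpos_nonpos) (auto intro: mult_nonneg_nonpos)
    finally show ?thesis .
  qed
qed

text \<open>Every link after the first costs at most \<open>K\<close>, so a chain of
  \<open>Suc n\<close> links loses only \<open>n * K\<close>.\<close>

lemma quasi_ultrametric_relpow: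
  fixes g :: "'n \<Rightarrow> 'n \<Rightarrow> real" and K :: real
  assumes quasi: "\<And>i j k. min (g i k) (g k j) - K \<le> g i j" and "K \<ge> 0"
    and "(i, j) \<in> {(i, j). t \<le> g i j} ^^ Suc n"
  shows "t - n * K \<le> g i j"
  using assms(3)
proof (induction n arbitrary: j)
  case (Suc n)
  then obtain k where "(i, k) \<in> {(i, j). t \<le> g i j} ^^ Suc n" "t \<le> g k j" by auto
  with Suc.IH have "t - n * K \<le> min (g i k) (g k j)"
    using \<open>K \<ge> 0\<close> by (simp add: order_trans[of _ t] add_increasing2)
  then have "t - n * K - K \<le> g i j" using quasi[of i k j] by linarith
  then show ?case by (simp add: algebra_simps)
qed simp

text \<open>Single linkage: \<open>h i j\<close> is the largest \<open>t\<close> such that \<open>i\<close> and \<open>j\<close> are joined by a chain along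
  which \<open>g \<ge> t\<close>. Chains can be shortened to bounded length, so \<open>h - g\<close> is bounded.\<close>

lemma quasi_ultrametric_approx:
  fixes g :: "'n::finite \<Rightarrow> 'n \<Rightarrow> real" and K :: real
  assumes sym: "\<And>i j. g i j = g j i" and quasi: "\<And>i j k. min (g i k) (g k j) - K \<le> g i j"
    and "K \<ge> 0"
  obtains h where "\<And>i j. h i j = h j i" "\<And>i j k. min (h i k) (h k j) \<le> h i j"
    "\<And>i j. g i j \<le> h i j" "\<And>i j. h i j \<le> g i j + card (UNIV :: ('n \<times> 'n) set) * K"
proof -
  define R where "R t = {(i, j). t \<le> g i j}" for t
  let ?V = "range (case_prod g)"
  \<comment> \<open>Thresholds are restricted to values of \<open>g\<close>, so that
    \<open>T i j\<close> is finite and its maximum is attained.\<close>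
  define T where "T i j = {t \<in> ?V. (i, j) \<in> (R t)\<^sup>+}" for i j
  define h where "h i j = Max (T i j)" for i j
  have fin: "finite (T i j)" for i j by (simp add: T_def)
  have g_T: "g i j \<in> T i j" for i j
    unfolding T_def R_def by (auto intro: image_eqI[of _ _ "(i, j)"])
  have h_T: "h i j \<in> T i j" for i j
    unfolding h_def using fin g_T[of i j] by (intro Max_in) auto
  have R_sym: "sym ((R t)\<^sup>+)" for t
    by (intro sym_trancl) (use sym in \<open>simp add: sym_def R_def\<close>)
  have T_sym: "T i j = T j i" for i j
    unfolding T_def using symD[OF R_sym] by blast
  show thesis
  proof
    show "h i j = h j i" for i j by (simp add: h_def T_sym)
    show "g i j \<le> h i j" for i j unfolding h_def using fin g_T by (intro Max_ge)
    show "min (h i k) (h k j) \<le> h i j" for i j k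
    proof -
      let ?t = "min (h i k) (h k j)"
      have anti: "(R s)\<^sup>+ \<subseteq> (R ?t)\<^sup>+" if "?t \<le> s" for s
        using that by (intro trancl_mono_subset) (auto simp: R_def)
      have "(i, k) \<in> (R ?t)\<^sup>+" "(k, j) \<in> (R ?t)\<^sup>+"
        using anti[of "h i k"] anti[of "h k j"] h_T[of i k] h_T[of k j] by (auto simp: T_def)
      moreover have "?t \<in> ?V" using h_T[of i k] h_T[of k j] by (auto simp: T_def min_def)
      ultimately have "?t \<in> T i j" by (auto simp: T_def)
      then show ?thesis unfolding h_def[of i j] using fin by (intro Max_ge)
    qed
    show "h i j \<le> g i j + card (UNIV :: ('n \<times> 'n) set) * K" for i j
    proof -
      let ?t = "h i j"
      have "(i, j) \<in> (R ?t)\<^sup>+" using h_T[of i j] by (simp add: T_def)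
      \<comment> \<open>In a finite relation a chain can be shortened to at most as many links as
        there are pairs; this bounds the loss independently of \<open>g\<close>.\<close>
      then obtain n where n: "0 < n" "n \<le> card (R ?t)" "(i, j) \<in> R ?t ^^ n"
        unfolding trancl_finite_eq_relpow[OF finite] by blast
      then obtain k where k: "n = Suc k" by (cases n) auto
      have "?t - k * K \<le> g i j"
        using n(3) unfolding R_def k
        by (rule quasi_ultrametric_relpow[where g = g, OF quasi \<open>K \<ge> 0\<close>])
      moreover have "card (R ?t) \<le> card (UNIV :: ('n \<times> 'n) set)" by (intro card_mono) auto
      then have "k \<le> card (UNIV :: ('n \<times> 'n) set)" using n(2) unfolding k by linarith
      then have "k * K \<le> card (UNIV :: ('n \<times> 'n) set) * K"
        using \<open>K \<ge> 0\<close> by (intro mult_right_mono) (simp_all only: of_nat_le_iff)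
      ultimately show ?thesis by linarith
    qed
  qed
qed

text \<open>Replacing \<open>g\<close> by a nearby ultrametric changes each bracket by at most twice
  the approximation error, and the sum for the ultrametric is nonpositive.\<close>

lemma quasi_ultrametric_sum_le:
  fixes g :: "'n::finite \<Rightarrow> 'n \<Rightarrow> real" and K :: real
  assumes cut: "\<And>S. (\<Sum>(i, j)\<in>I. a i j * of_bool ((i \<in> S) \<noteq> (j \<in> S))) \<le> 0"
    and sym: "\<And>i j. g i j = g j i" and quasi: "\<And>i j k. min (g i k) (g k j) - K \<le> g i j"
    and "K \<ge> 0"
  shows "(\<Sum>(i, j)\<in>I. a i j * (g i i + g j j - 2 * g i j))
    \<le> 2 * card (UNIV :: ('n \<times> 'n) set) * K * (\<Sum>(i, j)\<in>I. \<bar>a i j\<bar>)"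
proof -
  let ?c = "card (UNIV :: ('n \<times> 'n) set) * K"
  obtain h where h: "\<And>i j. h i j = h j i" "\<And>i j k. min (h i k) (h k j) \<le> h i j"
    and gh: "\<And>i j. g i j \<le> h i j" "\<And>i j. h i j \<le> g i j + ?c"
    using quasi_ultrametric_approx[where g = g, OF sym quasi \<open>K \<ge> 0\<close>] by metis
  have "a i j * (g i i + g j j - 2 * g i j) \<le> a i j * (h i i + h j j - 2 * h i j) + 2 * ?c * \<bar>a i j\<bar>" for i j
  proof -
    let ?d = "(g i i + g j j - 2 * g i j) - (h i i + h j j - 2 * h i j)"
    have "\<bar>?d\<bar> \<le> 2 * ?c"
      using gh[of i i] gh[of j j] gh[of i j] by linarith
    then have "\<bar>a i j\<bar> * \<bar>?d\<bar> \<le> \<bar>a i j\<bar> * (2 * ?c)" by (intro mult_left_mono) simp_all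
    then have "a i j * ?d \<le> \<bar>a i j\<bar> * (2 * ?c)" by (simp only: flip: abs_mult)
    then show ?thesis by (simp only: right_diff_distrib mult.commute[of "\<bar>a i j\<bar>"])
  qed
  then have "(\<Sum>(i, j)\<in>I. a i j * (g i i + g j j - 2 * g i j))
      \<le> (\<Sum>(i, j)\<in>I. a i j * (h i i + h j j - 2 * h i j) + 2 * ?c * \<bar>a i j\<bar>)"
    by (intro sum_mono) auto
  also have "\<dots> = (\<Sum>(i, j)\<in>I. a i j * (h i i + h j j - 2 * h i j)) + 2 * ?c * (\<Sum>(i, j)\<in>I. \<bar>a i j\<bar>)"
    by (simp add: case_prod_unfold sum.distrib sum_distrib_left)
  also have "\<dots> \<le> 2 * ?c * (\<Sum>(i, j)\<in>I. \<bar>a i j\<bar>)"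
    using ultrametric_sum_nonpos[where g = h and a = a, OF cut h] by simp
  finally show ?thesis by (simp add: mult_ac)
qed

subsection \<open>Bounded ratios\<close>

lemma pos_lorentzian_iff:
  "A \<in> pos_lorentzian \<longleftrightarrow> transpose A = A \<and> (\<forall>i j. A $ i $ j > 0) \<and>
    (\<exists>w. \<forall>x. w \<bullet> x = 0 \<longrightarrow> x \<bullet> (A *v x) \<le> 0)"
  unfolding pos_lorentzian_def lorentzian_def
  using num_positive_eigenvalues_le_1_iff[of A] by (auto intro: less_imp_le)

lemma pos_lorentzian_sym: "A \<in> pos_lorentzian \<Longrightarrow> A $ i $ j = A $ j $ i"
  unfolding pos_lorentzian_iff by (metis transpose_def vec_lambda_beta)

text \<open>A reverse Cauchy-Schwarz principle: the hyperplane of \<open>w\<close> may be replaced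
  by the \<open>A\<close>-orthogonal complement of any vector on which the form is positive.\<close>

lemma pos_lorentzian_nonpos_on_complement:
  assumes A: "A \<in> pos_lorentzian" and u: "u \<bullet> (A *v u) > 0" and ortho: "u \<bullet> (A *v x) = 0"
  shows "x \<bullet> (A *v x) \<le> 0"
proof -
  obtain w where w: "\<And>x. w \<bullet> x = 0 \<Longrightarrow> x \<bullet> (A *v x) \<le> 0"
    using A unfolding pos_lorentzian_iff by blast
  have ortho': "x \<bullet> (A *v u) = 0"
    using A ortho symmetric_inner_commute[of A x u] by (simp add: pos_lorentzian_iff inner_commute)
  have wu: "w \<bullet> u \<noteq> 0" using w[of u] u by linarith
  \<comment> \<open>\<open>?y\<close> is the combination of \<open>x\<close> and \<open>u\<close> in
    the hyperplane of \<open>w\<close>; by orthogonality the form has no cross term there.\<close>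
  let ?y = "(w \<bullet> u) *\<^sub>R x - (w \<bullet> x) *\<^sub>R u"
  have "w \<bullet> ?y = 0" by (simp add: inner_diff_right)
  then have "?y \<bullet> (A *v ?y) \<le> 0" by (rule w)
  also have "?y \<bullet> (A *v ?y) = (w \<bullet> u)\<^sup>2 * (x \<bullet> (A *v x)) + (w \<bullet> x)\<^sup>2 * (u \<bullet> (A *v u))"
    by (simp add: matrix_vector_mult_diff_distrib matrix_vector_mult_scaleR inner_diff_left
        inner_diff_right ortho ortho' power2_eq_square)
  finally have "(w \<bullet> u)\<^sup>2 * (x \<bullet> (A *v x)) + (w \<bullet> x)\<^sup>2 * (u \<bullet> (A *v u)) \<le> 0" .
  moreover have "0 \<le> (w \<bullet> x)\<^sup>2 * (u \<bullet> (A *v u))" using u by simp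
  ultimately have "(w \<bullet> u)\<^sup>2 * (x \<bullet> (A *v x)) \<le> 0" by linarith
  then show ?thesis using wu by (simp add: mult_le_0_iff)
qed

text \<open>A four-point condition for the Gromov hyperbolic distance \<open>ln (p i j)\<close>. The vector \<open>z\<close> is a multiple
  of \<open>e\<^sub>i / p i l - 2 e\<^sub>k / p k l + e\<^sub>j / p j l\<close>, which is orthogonal to \<open>e\<^sub>l\<close>.\<close>

lemma pos_lorentzian_four_point:
  assumes A: "A \<in> pos_lorentzian"
  shows "A $ i $ j * A $ k $ l \<le> 2 * (A $ i $ k * A $ j $ l + A $ k $ j * A $ i $ l)"
proof -
  have pos: "\<And>i j. A $ i $ j > 0" using A by (simp add: pos_lorentzian_iff)
  have sym: "\<And>i j. A $ i $ j = A $ j $ i" using A by (rule pos_lorentzian_sym)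
  let ?e = "\<lambda>i. axis i 1 :: real^'a"
  have entry: "?e i \<bullet> (A *v ?e j) = A $ i $ j" for i j
    by (simp add: matrix_vector_mult_basis inner_axis' column_def)
  define a b c where abc: "a = A $ i $ l" "b = A $ j $ l" "c = A $ k $ l"
  have abc_pos: "a > 0" "b > 0" "c > 0" by (simp_all add: abc pos)
  define z where "z = (b * c) *\<^sub>R ?e i - (2 * a * b) *\<^sub>R ?e k + (a * c) *\<^sub>R ?e j"
  have Az: "A *v z = (b * c) *\<^sub>R (A *v ?e i) - (2 * a * b) *\<^sub>R (A *v ?e k) + (a * c) *\<^sub>R (A *v ?e j)"
    unfolding z_def by (simp only: matrix_vector_right_distrib matrix_vector_mult_diff_distrib
        matrix_vector_mult_scaleR)
  have "z \<bullet> (A *v z) \<le> 0"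
  proof (rule pos_lorentzian_nonpos_on_complement[OF A])
    show "?e l \<bullet> (A *v ?e l) > 0" using pos by (simp only: entry)
    show "?e l \<bullet> (A *v z) = 0"
      unfolding Az inner_add_right inner_diff_right inner_scaleR_right entry
      by (simp add: abc sym[of l])
  qed
  also have "z \<bullet> (A *v z) = (b * c)\<^sup>2 * A $ i $ i + (2 * a * b)\<^sup>2 * A $ k $ k + (a * c)\<^sup>2 * A $ j $ j
      + 2 * a * b * c * (c * A $ i $ j - 2 * b * A $ i $ k - 2 * a * A $ k $ j)"
    unfolding Az unfolding z_def inner_add_right inner_diff_right inner_scaleR_right
      inner_add_left inner_diff_left inner_scaleR_left entry sym[of j i] sym[of k i] sym[of j k]
    by (simp add: power2_eq_square algebra_simps)
  finally have "(b * c)\<^sup>2 * A $ i $ i + (2 * a * b)\<^sup>2 * A $ k $ k + (a * c)\<^sup>2 * A $ j $ j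
      + 2 * a * b * c * (c * A $ i $ j - 2 * b * A $ i $ k - 2 * a * A $ k $ j) \<le> 0" .
  moreover have "0 \<le> (b * c)\<^sup>2 * A $ i $ i" "0 \<le> (2 * a * b)\<^sup>2 * A $ k $ k" "0 \<le> (a * c)\<^sup>2 * A $ j $ j"
    using pos by (simp_all add: less_imp_le)
  ultimately have "2 * a * b * c * (c * A $ i $ j - 2 * b * A $ i $ k - 2 * a * A $ k $ j) \<le> 0"
    by linarith
  moreover have "2 * a * b * c > 0" using abc_pos by simp
  ultimately have "c * A $ i $ j - 2 * b * A $ i $ k - 2 * a * A $ k $ j \<le> 0"
    by (metis mult_le_0_iff not_less)
  then show ?thesis by (simp add: abc algebra_simps)
qed

text \<open>The bound depends only on the dimension and the coefficients, hence is uniform in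
  \<open>A\<close>.\<close>

lemma pos_lorentzian_sum_ln_le:
  fixes A :: "'n::finite sqmat"
  assumes A: "A \<in> pos_lorentzian"
    and cut: "\<And>S. (\<Sum>(i, j)\<in>I. a i j * of_bool ((i \<in> S) \<noteq> (j \<in> S))) \<le> 0"
  shows "(\<Sum>(i, j)\<in>I. a i j * (2 * ln (A $ i $ j) - ln (A $ i $ i) - ln (A $ j $ j)))
    \<le> 2 * card (UNIV :: ('n \<times> 'n) set) * ln 4 * (\<Sum>(i, j)\<in>I. \<bar>a i j\<bar>)"
proof -
  have pos: "\<And>i j. A $ i $ j > 0" using A by (simp add: pos_lorentzian_iff)
  have sym: "\<And>i j. A $ i $ j = A $ j $ i" using A by (rule pos_lorentzian_sym)
  \<comment> \<open>An arbitrary base point: \<open>g\<close> below is the Gromov product at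
    \<open>l\<close>, and in \<open>combo\<close> the dependence on \<open>l\<close>
    cancels.\<close>
  fix l :: 'n
  define g where "g i j = ln (A $ i $ l) + ln (A $ j $ l) - ln (A $ i $ j)" for i j
  have quasi: "min (g i k) (g k j) - ln 4 \<le> g i j" for i j k
  proof -
    \<comment> \<open>A sum of two terms is at most twice the larger one, which turns the factor 2
      into 4.\<close>
    have "A $ i $ j * A $ k $ l \<le> 4 * (A $ i $ k * A $ j $ l) \<or> A $ i $ j * A $ k $ l \<le> 4 * (A $ k $ j * A $ i $ l)"
      using pos_lorentzian_four_point[OF A, of i j k l] by (smt (verit))
    then have "ln (A $ i $ j * A $ k $ l) \<le> ln (4 * (A $ i $ k * A $ j $ l)) \<or>
        ln (A $ i $ j * A $ k $ l) \<le> ln (4 * (A $ k $ j * A $ i $ l))"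
      using pos by (simp add: ln_le_cancel_iff)
    then have "ln (A $ i $ j) + ln (A $ k $ l) \<le> ln 4 + (ln (A $ i $ k) + ln (A $ j $ l)) \<or>
        ln (A $ i $ j) + ln (A $ k $ l) \<le> ln 4 + (ln (A $ k $ j) + ln (A $ i $ l))"
      using pos by (simp add: ln_mult_pos)
    then show ?thesis unfolding g_def by linarith
  qed
  have combo: "g i i + g j j - 2 * g i j = 2 * ln (A $ i $ j) - ln (A $ i $ i) - ln (A $ j $ j)" for i j
    by (simp add: g_def)
  have "g i j = g j i" for i j by (simp add: g_def sym[of i j])
  then have "(\<Sum>(i, j)\<in>I. a i j * (g i i + g j j - 2 * g i j))
      \<le> 2 * card (UNIV :: ('n \<times> 'n) set) * ln 4 * (\<Sum>(i, j)\<in>I. \<bar>a i j\<bar>)"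
    by (intro quasi_ultrametric_sum_le cut quasi) simp_all
  then show ?thesis unfolding combo .
qed

section \<open>Test matrices that force the linear conditions\<close>

lemma prod_powr_eq_exp:
  fixes p a :: "'i \<Rightarrow> 'j \<Rightarrow> real"
  assumes "finite I" "\<And>i j. p i j > 0"
  shows "(\<Prod>(i, j)\<in>I. p i j powr a i j) = exp (\<Sum>(i, j)\<in>I. a i j * ln (p i j))"
  using assms(1)
proof (induction I)
  case (insert z I)
  then show ?case using assms(2)[of "fst z" "snd z"]
    by (simp add: case_prod_unfold powr_def exp_add)
qed simp

lemma exp_mult_bounded_imp_nonpos:
  fixes s c :: real
  assumes "\<And>u. u \<ge> 0 \<Longrightarrow> exp (u * s) \<le> c"
  shows "s \<le> 0"
proof (rule ccontr)
  assume s: "\<not> s \<le> 0"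
  have "c > 0" using assms[of 0] by simp
  \<comment> \<open>The choice \<open>u = c / s\<close> makes the exponent equal to the
    bound.\<close>
  then have "exp c \<le> c" using assms[of "c / s"] s by simp
  then show False using exp_ge_add_one_self[of c] by linarith
qed

text \<open>On vectors with coordinate sum 0 the form equals \<open>- 2 * (exp u - 1)\<close> times
  the square of the coordinate sum over \<open>S\<close>.\<close>

lemma cut_matrix_pos_lorentzian:
  fixes S :: "'n::finite set"
  assumes "u \<ge> 0"
  shows "(\<chi> i j. exp (u * of_bool ((i \<in> S) \<noteq> (j \<in> S)))) \<in> pos_lorentzian" (is "?A \<in> _")
proof -
  have "x \<bullet> (?A *v x) \<le> 0" if "1 \<bullet> x = 0" for x :: "real^'n"
  proof -
    let ?s = "\<lambda>i. of_bool (i \<in> S) :: real"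
    define a where "a = (\<Sum>i\<in>UNIV. ?s i * x $ i)"
    have x0: "(\<Sum>i\<in>UNIV. x $ i) = 0" using that by (simp add: inner_vec_def)
    \<comment> \<open>The separation indicator is \<open>?s i + ?s j - 2 * ?s i * ?s j\<close>, so
      each row is affine in \<open>?s j\<close>.\<close>
    have entry: "?A $ i $ j = (1 + (exp u - 1) * ?s i) + ((exp u - 1) * (1 - 2 * ?s i)) * ?s j" for i j
      by (cases "i \<in> S"; cases "j \<in> S") simp_all
    have row: "(?A *v x) $ i = (exp u - 1) * a * (1 - 2 * ?s i)" for i
    proof -
      have "(?A *v x) $ i = (\<Sum>j\<in>UNIV. ?A $ i $ j * x $ j)"
        by (simp only: matrix_vector_mult_def vec_lambda_beta)
      also have "\<dots> = (1 + (exp u - 1) * ?s i) * (\<Sum>j\<in>UNIV. x $ j) + (exp u - 1) * (1 - 2 * ?s i) * a"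
        unfolding entry a_def sum_distrib_left sum.distrib[symmetric]
        by (intro sum.cong refl) (simp only: distrib_right mult.assoc)
      finally show ?thesis by (simp add: x0)
    qed
    have "x \<bullet> (?A *v x) = (exp u - 1) * a * ((\<Sum>i\<in>UNIV. x $ i) - 2 * a)"
      unfolding inner_vec_def row a_def sum_distrib_left sum_subtractf[symmetric]
      by (intro sum.cong refl) (simp add: algebra_simps)
    also have "\<dots> = - (2 * (exp u - 1) * a\<^sup>2)" by (simp add: x0 power2_eq_square)
    also have "\<dots> \<le> 0" using assms by simp
    finally show ?thesis .
  qed
  moreover have "transpose ?A = ?A" by (auto simp: transpose_def vec_eq_iff)
  ultimately show ?thesis unfolding pos_lorentzian_iff by auto
qed

text \<open>These are the rescalings of the all-ones matrix; the form is the square of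
  \<open>c \<bullet> x\<close>.\<close>

lemma rank_one_pos_lorentzian:
  fixes c :: "real^'n::finite"
  assumes "\<And>i. c $ i > 0"
  shows "(\<chi> i j. c $ i * c $ j) \<in> pos_lorentzian" (is "?A \<in> _")
proof -
  have "?A *v x = (c \<bullet> x) *\<^sub>R c" for x
    by (simp add: matrix_vector_mult_def inner_vec_def vec_eq_iff sum_distrib_left mult_ac)
  then have "x \<bullet> (?A *v x) \<le> 0" if "c \<bullet> x = 0" for x using that by simp
  moreover have "transpose ?A = ?A" by (simp add: transpose_def vec_eq_iff mult.commute)
  ultimately show ?thesis unfolding pos_lorentzian_iff using assms by auto
qed

text \<open>On the cut matrix of \<open>S\<close> with parameter \<open>u\<close> the product is
  \<open>exp (u * s)\<close>, where \<open>s\<close> is the sum in the conclusion; let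
  \<open>u\<close> grow.\<close>

lemma bounded_on_unit_diagonal_imp_cut:
  fixes a :: "'n::finite \<Rightarrow> 'n \<Rightarrow> real"
  assumes "\<And>p. p \<in> unit_diagonal pos_lorentzian \<Longrightarrow> (\<Prod>(i, j)\<in>I. (p $ i $ j) powr a i j) \<le> c"
  shows "(\<Sum>(i, j)\<in>I. a i j * of_bool ((i \<in> S) \<noteq> (j \<in> S))) \<le> 0" (is "?s \<le> 0")
proof (rule exp_mult_bounded_imp_nonpos)
  fix u :: real assume u: "u \<ge> 0"
  let ?A = "\<chi> i j. exp (u * of_bool ((i \<in> S) \<noteq> (j \<in> S)))"
  have "exp (u * ?s) = exp (\<Sum>(i, j)\<in>I. a i j * ln (?A $ i $ j))"
    unfolding sum_distrib_left by (intro arg_cong[where f = exp] sum.cong refl) auto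
  also have "\<dots> = (\<Prod>(i, j)\<in>I. (?A $ i $ j) powr a i j)"
    by (subst prod_powr_eq_exp) simp_all
  also have "\<dots> \<le> c"
    using cut_matrix_pos_lorentzian[OF u, of S] by (intro assms) (simp add: unit_diagonal_def)
  finally show "exp (u * ?s) \<le> c" .
qed

text \<open>Rescaling index \<open>k\<close> of the all-ones matrix by \<open>exp u\<close> makes
  the product \<open>exp (u * s)\<close>, where \<open>s\<close> is the sum in the conclusion. Here
  \<open>u\<close> may have either sign, so an equation results.\<close>

lemma bounded_imp_balanced:
  fixes a :: "'n::finite \<Rightarrow> 'n \<Rightarrow> real"
  assumes "\<And>p. p \<in> pos_lorentzian \<Longrightarrow> (\<Prod>(i, j)\<in>I. (p $ i $ j) powr a i j) \<le> c"
  shows "(\<Sum>(i, j)\<in>I. a i j * (of_bool (i = k) + of_bool (j = k))) = 0" (is "?s = 0")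
proof -
  have bound: "exp (u * ?s) \<le> c" for u
  proof -
    let ?c = "\<chi> i. exp (u * of_bool (i = k))"
    let ?A = "\<chi> i j. ?c $ i * ?c $ j"
    have "exp (u * ?s) = exp (\<Sum>(i, j)\<in>I. a i j * ln (?A $ i $ j))"
      by (simp add: case_prod_unfold sum_distrib_left ln_mult_pos algebra_simps)
    also have "\<dots> = (\<Prod>(i, j)\<in>I. (?A $ i $ j) powr a i j)"
      by (subst prod_powr_eq_exp) simp_all
    also have "\<dots> \<le> c" by (intro assms rank_one_pos_lorentzian) simp
    finally show ?thesis .
  qed
  have "?s \<le> 0" using bound by (rule exp_mult_bounded_imp_nonpos)
  moreover have "- ?s \<le> 0"
    by (rule exp_mult_bounded_imp_nonpos[of _ c]) (use bound[of "- _"] in simp)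
  ultimately show ?thesis by simp
qed

section \<open>Description of both cones by linear conditions\<close>

lemma reduced_BR_pos_lorentzian:
  "reduced_BR (pos_lorentzian :: 'n::{finite,linorder} sqmat set) = {\<alpha> \<in> vectors_on pairs_less.
    \<forall>S. (\<Sum>(i, j)\<in>pairs_less. \<alpha> $ i $ j * of_bool ((i \<in> S) \<noteq> (j \<in> S))) \<le> 0}" (is "_ = ?R")
proof (intro set_eqI iffI)
  fix \<alpha> :: "'n sqmat" assume "\<alpha> \<in> reduced_BR pos_lorentzian"
  then show "\<alpha> \<in> ?R"
    unfolding reduced_BR_def
    using bounded_on_unit_diagonal_imp_cut[where a = "\<lambda>i j. \<alpha> $ i $ j" and I = pairs_less] by blast
next
  fix \<alpha> :: "'n sqmat" assume \<alpha>: "\<alpha> \<in> ?R"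
  \<comment> \<open>The estimate controls twice the logarithm of the product, hence the bound
    \<open>exp (?C / 2)\<close>.\<close>
  let ?C = "2 * card (UNIV :: ('n \<times> 'n) set) * ln 4 * (\<Sum>(i, j)\<in>pairs_less. \<bar>\<alpha> $ i $ j\<bar>)"
  have "(\<Prod>(i, j)\<in>pairs_less. (p $ i $ j) powr (\<alpha> $ i $ j)) \<le> exp (?C / 2)"
    if p: "p \<in> unit_diagonal pos_lorentzian" for p
  proof -
    have A: "p \<in> pos_lorentzian" and diag: "\<And>i. p $ i $ i = 1" and pos: "\<And>i j. p $ i $ j > 0"
      using p by (auto simp: unit_diagonal_def pos_lorentzian_iff)
    have "(\<Sum>(i, j)\<in>pairs_less. \<alpha> $ i $ j * (2 * ln (p $ i $ j) - ln (p $ i $ i) - ln (p $ j $ j))) \<le> ?C"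
      using \<alpha> by (intro pos_lorentzian_sum_ln_le A) blast
    then have "2 * (\<Sum>(i, j)\<in>pairs_less. \<alpha> $ i $ j * ln (p $ i $ j)) \<le> ?C"
      by (simp add: diag case_prod_unfold sum_distrib_left mult_ac)
    then show ?thesis using pos by (subst prod_powr_eq_exp) simp_all
  qed
  then show "\<alpha> \<in> reduced_BR pos_lorentzian"
    using \<alpha> unfolding reduced_BR_def by (auto intro!: exI[of _ "exp (?C / 2)"])
qed

text \<open>The balance equations express invariance of the product under rescaling; they make the
  diagonal logarithms in the estimate cancel. Pairs with \<open>i = j\<close> contribute nothing to
  the cut sums.\<close>

lemma BR_pos_lorentzian:
  "BR (pos_lorentzian :: 'n::{finite,linorder} sqmat set) = {\<alpha> \<in> vectors_on pairs_le.
    (\<forall>k. (\<Sum>(i, j)\<in>pairs_le. \<alpha> $ i $ j * (of_bool (i = k) + of_bool (j = k))) = 0) \<and>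
    (\<forall>S. (\<Sum>(i, j)\<in>pairs_le. \<alpha> $ i $ j * of_bool ((i \<in> S) \<noteq> (j \<in> S))) \<le> 0)}" (is "_ = ?R")
proof (intro set_eqI iffI)
  fix \<alpha> :: "'n sqmat" assume "\<alpha> \<in> BR pos_lorentzian"
  then obtain c where \<alpha>: "\<alpha> \<in> vectors_on pairs_le"
    and c: "\<And>p. p \<in> pos_lorentzian \<Longrightarrow> (\<Prod>(i, j)\<in>pairs_le. (p $ i $ j) powr (\<alpha> $ i $ j)) \<le> c"
    unfolding BR_def by blast
  have "\<And>p. p \<in> unit_diagonal pos_lorentzian \<Longrightarrow> p \<in> (pos_lorentzian :: 'n sqmat set)"
    by (simp add: unit_diagonal_def)
  then show "\<alpha> \<in> ?R"
    using \<alpha> bounded_imp_balanced[where a = "\<lambda>i j. \<alpha> $ i $ j", OF c]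
      bounded_on_unit_diagonal_imp_cut[where a = "\<lambda>i j. \<alpha> $ i $ j", OF c] by blast
next
  fix \<alpha> :: "'n sqmat" assume \<alpha>: "\<alpha> \<in> ?R"
  let ?C = "2 * card (UNIV :: ('n \<times> 'n) set) * ln 4 * (\<Sum>(i, j)\<in>pairs_le. \<bar>\<alpha> $ i $ j\<bar>)"
  have "(\<Prod>(i, j)\<in>pairs_le. (p $ i $ j) powr (\<alpha> $ i $ j)) \<le> exp (?C / 2)"
    if p: "p \<in> pos_lorentzian" for p
  proof -
    have pos: "\<And>i j. p $ i $ j > 0" using p by (simp add: pos_lorentzian_iff)
    let ?l = "\<lambda>k. ln (p $ k $ k)"
    \<comment> \<open>Collecting the coefficient of each \<open>?l k\<close> turns the sum into a
      combination of balance equations.\<close>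
    have "(\<Sum>(i, j)\<in>pairs_le. \<alpha> $ i $ j * (?l i + ?l j)) =
        (\<Sum>(i, j)\<in>pairs_le. \<Sum>k\<in>UNIV. ?l k * (\<alpha> $ i $ j * (of_bool (i = k) + of_bool (j = k))))"
      by (intro sum.cong refl) (auto simp: distrib_left sum.distrib simp flip: mult.assoc)
    also have "\<dots> = (\<Sum>k\<in>UNIV. ?l k * (\<Sum>(i, j)\<in>pairs_le. \<alpha> $ i $ j * (of_bool (i = k) + of_bool (j = k))))"
      unfolding sum_distrib_left case_prod_unfold by (rule sum.swap)
    also have "\<dots> = 0" using \<alpha> by simp
    finally have diag: "(\<Sum>(i, j)\<in>pairs_le. \<alpha> $ i $ j * (?l i + ?l j)) = 0" .
    have "2 * (\<Sum>(i, j)\<in>pairs_le. \<alpha> $ i $ j * ln (p $ i $ j)) =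
        (\<Sum>(i, j)\<in>pairs_le. \<alpha> $ i $ j * (2 * ln (p $ i $ j) - ?l i - ?l j))
        + (\<Sum>(i, j)\<in>pairs_le. \<alpha> $ i $ j * (?l i + ?l j))"
      unfolding sum_distrib_left sum.distrib[symmetric]
      by (intro sum.cong refl) (auto simp: algebra_simps)
    also have "\<dots> \<le> ?C + 0"
      unfolding diag using \<alpha> by (intro add_right_mono pos_lorentzian_sum_ln_le p) blast
    finally show ?thesis using pos by (subst prod_powr_eq_exp) simp_all
  qed
  then show "\<alpha> \<in> BR pos_lorentzian"
    using \<alpha> unfolding BR_def by (auto intro!: exI[of _ "exp (?C / 2)"])
qed

text \<open>A homogeneous linear inequality defines a convex cone, so it need only be tested on the
  generators.\<close>

lemma dual_cut_cone_iff:
  "(\<forall>\<beta>\<in>cut_cone. (\<Sum>(i, j)\<in>pairs_less. \<alpha> $ i $ j * \<beta> $ i $ j) \<le> 0) \<longleftrightarrow>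
   (\<forall>S. (\<Sum>(i, j)\<in>pairs_less. \<alpha> $ i $ j * of_bool ((i \<in> S) \<noteq> (j \<in> S))) \<le> 0)"
  (is "(\<forall>\<beta>\<in>_. ?f \<beta> \<le> 0) \<longleftrightarrow> _")
proof -
  have "convex_cone {\<beta>. ?f \<beta> \<le> 0}"
    unfolding convex_cone_iff
    by (auto simp: case_prod_unfold distrib_left sum.distrib mult.left_commute
        simp flip: sum_distrib_left intro: add_nonpos_nonpos mult_nonneg_nonpos)
  then have hull: "cut_cone \<subseteq> {\<beta>. ?f \<beta> \<le> 0} \<longleftrightarrow> range cut_vector \<subseteq> {\<beta>. ?f \<beta> \<le> 0}"
    unfolding cut_cone_def by (rule subset_hull)
  have eval: "?f (cut_vector S) = (\<Sum>(i, j)\<in>pairs_less. \<alpha> $ i $ j * of_bool ((i \<in> S) \<noteq> (j \<in> S)))" for S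
    by (intro sum.cong refl) (auto simp: cut_vector_def pairs_less_def)
  have "(\<forall>\<beta>\<in>cut_cone. ?f \<beta> \<le> 0) \<longleftrightarrow> cut_cone \<subseteq> {\<beta>. ?f \<beta> \<le> 0}"
    by (simp only: subset_eq mem_Collect_eq)
  also note hull
  also have "range cut_vector \<subseteq> {\<beta>. ?f \<beta> \<le> 0} \<longleftrightarrow> (\<forall>S. ?f (cut_vector S) \<le> 0)"
    by (simp only: image_subset_iff mem_Collect_eq UNIV_I ball_UNIV)
  finally show ?thesis unfolding eval .
qed

text \<open>Writes the sums over pairs as inner products, the form in which half-spaces enter the
  double description method.\<close>

lemma inner_masked:
  fixes \<alpha> :: "'n::finite sqmat"
  shows "(\<chi> i j. if (i, j) \<in> I then f i j else 0) \<bullet> \<alpha> = (\<Sum>(i, j)\<in>I. \<alpha> $ i $ j * f i j)"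
proof -
  have "(\<chi> i j. if (i, j) \<in> I then f i j else 0) \<bullet> \<alpha> =
      (\<Sum>(i, j)\<in>UNIV. if (i, j) \<in> I then \<alpha> $ i $ j * f i j else 0)"
    unfolding inner_vec_def UNIV_Times_UNIV[symmetric] sum.cartesian_product[symmetric]
    by (intro sum.cong refl) simp
  also have "\<dots> = (\<Sum>(i, j)\<in>I. \<alpha> $ i $ j * f i j)"
    by (intro sum.mono_neutral_cong_right) auto
  finally show ?thesis .
qed

text \<open>Each equation becomes two opposite inequalities; finiteness holds because there are
  finitely many pairs, indices and subsets.\<close>

lemma BR_pos_lorentzian_halfspaces:
  obtains F :: "'n::{finite,linorder} sqmat set" where "finite F" "\<And>a. a \<in> F \<Longrightarrow> integral_vector a"
    "BR pos_lorentzian = {\<alpha>. \<forall>a\<in>F. a \<bullet> \<alpha> \<le> 0}"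
proof -
  define mask :: "('n \<times> 'n) set \<Rightarrow> ('n \<Rightarrow> 'n \<Rightarrow> real) \<Rightarrow> 'n sqmat"
    where "mask I f = (\<chi> i j. if (i, j) \<in> I then f i j else 0)" for I f
  have inner: "mask I f \<bullet> \<alpha> = (\<Sum>(i, j)\<in>I. \<alpha> $ i $ j * f i j)" for I f \<alpha>
    unfolding mask_def by (rule inner_masked)
  \<comment> \<open>\<open>U\<close> encodes the vanishing of entries outside
    \<open>pairs_le\<close>, \<open>B\<close> the balance equations and \<open>C\<close> the cut
    inequalities.\<close>
  define U where "U = (\<lambda>z. mask {z} (\<lambda>i j. 1)) ` (- pairs_le)"
  define B where "B = range (\<lambda>k. mask pairs_le (\<lambda>i j. of_bool (i = k) + of_bool (j = k)))"
  define C where "C = range (\<lambda>S. mask pairs_le (\<lambda>i j. of_bool ((i \<in> S) \<noteq> (j \<in> S))))"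
  let ?F = "U \<union> uminus ` U \<union> B \<union> uminus ` B \<union> C"
  have "integral_vector a" if "a \<in> U \<union> B \<union> C" for a
    using that by (auto simp: U_def B_def C_def mask_def integral_vector_def of_bool_def)
  then have "integral_vector a" if "a \<in> ?F" for a
    using that by (auto intro: integral_vector_uminus)
  moreover have "BR pos_lorentzian = {\<alpha>. \<forall>a\<in>?F. a \<bullet> \<alpha> \<le> 0}"
  proof -
    have "(\<forall>a\<in>U. a \<bullet> \<alpha> = 0) \<longleftrightarrow> (\<forall>z\<in>- pairs_le. \<alpha> $ fst z $ snd z = 0)" for \<alpha>
      by (simp add: U_def inner case_prod_unfold)
    then have U: "\<alpha> \<in> vectors_on pairs_le \<longleftrightarrow> (\<forall>a\<in>U. a \<bullet> \<alpha> = 0)" for \<alpha>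
      by (force simp: vectors_on_def)
    have B: "(\<forall>k. (\<Sum>(i, j)\<in>pairs_le. \<alpha> $ i $ j * (of_bool (i = k) + of_bool (j = k))) = 0)
        \<longleftrightarrow> (\<forall>a\<in>B. a \<bullet> \<alpha> = 0)" for \<alpha>
      unfolding B_def by (simp add: inner)
    have C: "(\<forall>S. (\<Sum>(i, j)\<in>pairs_le. \<alpha> $ i $ j * of_bool ((i \<in> S) \<noteq> (j \<in> S))) \<le> 0)
        \<longleftrightarrow> (\<forall>a\<in>C. a \<bullet> \<alpha> \<le> 0)" for \<alpha>
      unfolding C_def by (simp add: inner)
    have zero: "(\<forall>a\<in>V. a \<bullet> \<alpha> = 0) \<longleftrightarrow> (\<forall>a\<in>V. a \<bullet> \<alpha> \<le> 0) \<and> (\<forall>a\<in>uminus ` V. a \<bullet> \<alpha> \<le> 0)"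
      for V and \<alpha> :: "'n sqmat"
      by (auto intro: antisym)
    show ?thesis
      unfolding BR_pos_lorentzian U B C zero ball_Un by (simp only: conj_assoc)
  qed
  moreover have "finite ?F" by (simp add: U_def B_def C_def)
  ultimately show thesis by (intro that[of ?F])
qed

lemma polyhedron_halfspaces:
  fixes F :: "'a::euclidean_space set"
  assumes "finite F"
  shows "polyhedron {x. \<forall>a\<in>F. a \<bullet> x \<le> 0}"
proof -
  have "{x. \<forall>a\<in>F. a \<bullet> x \<le> 0} = \<Inter> ((\<lambda>a. {x. a \<bullet> x \<le> 0}) ` F)" by blast
  then show ?thesis using assms by (auto intro: polyhedron_halfspace_le)
qed

theorem theoremB:
  shows "reduced_BR (pos_lorentzian :: 'n::{finite,linorder} sqmat set) =
           {\<alpha> \<in> vectors_on pairs_less.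
              \<forall>\<beta>\<in>cut_cone. (\<Sum>(i, j)\<in>pairs_less. \<alpha> $ i $ j * \<beta> $ i $ j) \<le> 0}
         \<and> polyhedron (BR (pos_lorentzian :: 'n::{finite,linorder} sqmat set))
         \<and> (\<exists>G. finite G \<and> (\<forall>g\<in>G. integral_vector g)
                \<and> BR (pos_lorentzian :: 'n::{finite,linorder} sqmat set) = convex_cone hull G)"
proof -
  obtain F :: "'n sqmat set" where F: "finite F" "\<And>a. a \<in> F \<Longrightarrow> integral_vector a"
    "BR pos_lorentzian = {\<alpha>. \<forall>a\<in>F. a \<bullet> \<alpha> \<le> 0}"
    using BR_pos_lorentzian_halfspaces by blast
  show ?thesis
    unfolding reduced_BR_pos_lorentzian dual_cut_cone_iff F(3)
    using polyhedron_halfspaces[OF F(1)] integral_generators[OF F(1,2)] by blast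
qed

end
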